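(* If $X_1,X_2$ are i.i.d. real-valued continuous random variables, then $$\frac12\leq\frac{h(X_1+X_2)-h(X_1)}{h(X_1-X_2)-h(X_1)}\leq 2,$$ equivalently $$\frac12\leq\frac{I(X_1+X_2;X_2)}{I(X_1-X_2;X_2)}\leq 2.$$ (In non-ratio form: $h(X_1+X_2)-h(X_1)\le 2[h(X_1-X_2)-h(X_1)]$ and $h(X_1-X_2)-h(X_1)\le 2[h(X_1+X_2)-h(X_1)]$.)
   Context: Standing conventions: all random variables are real-valued with densities (random vectors have joint densities), and every differential entropy appearing is assumed to exist and be finite. $h$ denotes differential entropy and $I(U;V)=h(U)+h(V)-h(U,V)$ mutual information. *)

theory Defs
  imports "HOL-Probability.Probability"
begin

definition diff_entropy :: "'a measure \<Rightarrow> ('a \<Rightarrow> real) \<Rightarrow> real" where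
  "diff_entropy M X = prob_space.entropy M (exp 1) lborel X"

definition has_finite_diff_entropy :: "'a measure \<Rightarrow> ('a \<Rightarrow> real) \<Rightarrow> bool" where
  "has_finite_diff_entropy M X \<longleftrightarrow>
     (\<exists>f :: real \<Rightarrow> real. (\<forall>x. 0 \<le> f x) \<and>
        distributed M lborel X (\<lambda>x. ennreal (f x)) \<and>
        integrable lborel (\<lambda>x. f x * ln (f x)))"

end

theory Submission
  imports Defs
begin

text \<open>Let \<open>f\<close>, \<open>g\<close>, \<open>d\<close> be the densities of \<open>X\<^sub>1\<close>, \<open>X\<^sub>1 + X\<^sub>2\<close>, \<open>X\<^sub>1 - X\<^sub>2\<close>. On three independent copies
  \<open>x, y, z\<close> of \<open>X\<^sub>1\<close>, each inequality is an instance of \<open>ln W \<le> W - 1\<close> for a ratio \<open>W\<close> of densities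
  with mean at most 1. The bound \<open>h(X\<^sub>1 - X\<^sub>2) + h(X\<^sub>1) \<le> 2 h(X\<^sub>1 + X\<^sub>2)\<close> (Ruzsa's triangle inequality)
  comes from \<open>W = g(x + z) g(y + z) / (d(x - y) f(z))\<close>. The bound
  \<open>h(X\<^sub>1 + X\<^sub>2) + h(X\<^sub>1) \<le> 2 h(X\<^sub>1 - X\<^sub>2)\<close> comes from \<open>W\<^sub>1 = d(x - z) d(y - z) / (k(x + y - z) f(z))\<close>
  and \<open>W\<^sub>2 = k(x + y - z) / g(x + y)\<close>, where \<open>k\<close> is the density of \<open>X\<^sub>1 + X\<^sub>2 - X\<^sub>3\<close>:
  \<open>k\<close> cancels in \<open>ln (W\<^sub>1 W\<^sub>2) \<le> W\<^sub>1 + W\<^sub>2 - 2\<close>, so its entropy need not be finite.\<close>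

section \<open>Cancellation, the logarithmic inequality in the mean, and densities under
  measure-preserving maps\<close>

lemma ennreal_mult_inverse_le:
  fixes a b :: ennreal
  shows "a * (b * inverse a) \<le> b"
proof -
  \<comment> \<open>Equality holds for \<open>0 < a < \<top>\<close>; for \<open>a = 0\<close> or
    \<open>a = \<top>\<close> the product is 0. With only \<le> claimed, a density in a denominator
    can later be cancelled against the same density as a weight, zeros included.\<close>
  have "a * inverse a \<le> 1"
    by (metis divide_ennreal_def ennreal_divide_self ennreal_divide_top linear mult_zero_left
        not_gr_zero top.not_eq_extremum zero_le)
  then have "b * (a * inverse a) \<le> b * 1"
    by (intro mult_left_mono) auto
  then show ?thesis
    by (simp add: ac_simps)
qed

lemma nn_integral_lborel_shift:
  fixes \<phi> :: "real \<Rightarrow> ennreal"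
  assumes [measurable]: "\<phi> \<in> borel_measurable borel"
  shows "(\<integral>\<^sup>+x. \<phi> (x + a) \<partial>lborel) = (\<integral>\<^sup>+x. \<phi> x \<partial>lborel)"
  using nn_integral_real_affine[of \<phi> 1 a] by (simp add: add.commute)

lemma nn_integral_lborel_reflect:
  fixes \<phi> :: "real \<Rightarrow> ennreal"
  assumes [measurable]: "\<phi> \<in> borel_measurable borel"
  shows "(\<integral>\<^sup>+x. \<phi> (a - x) \<partial>lborel) = (\<integral>\<^sup>+x. \<phi> x \<partial>lborel)"
  using nn_integral_real_affine[of \<phi> "-1" a] by simp

text \<open>The mean form of \<open>ln W \<le> W - 1\<close>, with \<open>L\<close> as
  \<open>ln W\<close> and \<open>V\<close> as \<open>W\<close>. Taking \<open>V\<close> in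
  \<open>ennreal\<close> reduces its integrability to the bound on its integral.\<close>

lemma (in prob_space) integral_nonpos_if_add_1_le:
  fixes L :: "'a \<Rightarrow> real"
  assumes L: "integrable M L"
    and le: "AE x in M. ennreal (1 + L x) \<le> V x"
    and V: "(\<integral>\<^sup>+x. V x \<partial>M) \<le> 1"
  shows "(\<integral>x. L x \<partial>M) \<le> 0"
proof -
  \<comment> \<open>\<open>ennreal\<close> truncates negative reals to 0, so \<open>V\<close> is
    compared with the positive part of \<open>1 + L\<close>, which in turn dominates
    \<open>1 + L\<close>.\<close>
  have int: "integrable M (\<lambda>x. max 0 (1 + L x))"
    using L by auto
  have "ennreal (\<integral>x. max 0 (1 + L x) \<partial>M) = (\<integral>\<^sup>+x. ennreal (max 0 (1 + L x)) \<partial>M)"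
    by (rule nn_integral_eq_integral[symmetric]) (use int in auto)
  also have "\<dots> \<le> (\<integral>\<^sup>+x. V x \<partial>M)"
    using le by (intro nn_integral_mono_AE) (auto simp: max_def ennreal_neg split: if_splits)
  finally have "(\<integral>x. max 0 (1 + L x) \<partial>M) \<le> 1"
    using V by (metis order_trans ennreal_le_1)
  moreover have "(\<integral>x. 1 + L x \<partial>M) \<le> (\<integral>x. max 0 (1 + L x) \<partial>M)"
    using int L by (intro integral_mono) auto
  ultimately show ?thesis
    using L by (simp add: prob_space)
qed

text \<open>The zero set of a density is null under the law it defines. This licenses
  \<open>ln_mult\<close>, \<open>ln_div\<close> and the real quotients almost everywhere.\<close>

lemma distributed_AE_pos:
  assumes D: "distributed M N T (\<lambda>x. ennreal (g x))"
  shows "AE x in M. 0 < g (T x)"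
proof -
  note [measurable] = distributed_measurable[OF D] distributed_borel_measurable[OF D]
  have "AE t in distr M N T. 0 < ennreal (g t)"
    unfolding distributed_distr_eq_density[OF D] by (subst AE_density) auto
  then have "AE x in M. 0 < ennreal (g (T x))"
    by (subst (asm) AE_distr_iff) measurable
  then show ?thesis
    by simp
qed

text \<open>Carries a law known on one or two copies over to the triple product, along a coordinate
  projection.\<close>

lemma distributed_compose_measure_preserving:
  assumes D: "distributed N K T g"
    and [measurable]: "\<pi> \<in> measurable M N"
    and \<pi>: "distr M N \<pi> = N"
  shows "distributed M K (\<lambda>x. T (\<pi> x)) g"
proof -
  note [measurable] = distributed_measurable[OF D] distributed_borel_measurable[OF D]
  have "distr M K (\<lambda>x. T (\<pi> x)) = distr (distr M N \<pi>) K T"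
    by (subst distr_distr) (auto simp: comp_def)
  then show ?thesis
    unfolding distributed_def using distributed_distr_eq_density[OF D] by (simp add: \<pi>)
qed

section \<open>Three independent copies of the common law\<close>

locale iid_sum_difference =
  fixes f g d :: "real \<Rightarrow> real"
  assumes f_nonneg: "\<And>x. 0 \<le> f x"
    and g_nonneg: "\<And>x. 0 \<le> g x"
    and d_nonneg: "\<And>x. 0 \<le> d x"
    and f_measurable [measurable]: "f \<in> borel_measurable borel"
    and prob_f: "prob_space (density lborel (\<lambda>x. ennreal (f x)))"
    and sum_distributed: "distributed (density lborel f \<Otimes>\<^sub>M density lborel f) lborel (\<lambda>(x, y). x + y) g"
    and diff_distributed: "distributed (density lborel f \<Otimes>\<^sub>M density lborel f) lborel (\<lambda>(x, y). x - y) d"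
    and f_ln: "integrable lborel (\<lambda>x. f x * ln (f x))"
    and g_ln: "integrable lborel (\<lambda>x. g x * ln (g x))"
    and d_ln: "integrable lborel (\<lambda>x. d x * ln (d x))"
begin

abbreviation \<mu> :: "real measure" where
  "\<mu> \<equiv> density lborel (\<lambda>x. ennreal (f x))"

text \<open>The original probability space need not carry a third independent copy; the triple
  product of the common law supplies one, and entropy depends on laws only.\<close>

abbreviation P :: "(real \<times> real \<times> real) measure" where
  "P \<equiv> \<mu> \<Otimes>\<^sub>M (\<mu> \<Otimes>\<^sub>M \<mu>)"

sublocale \<mu>: prob_space \<mu>
  by (rule prob_f)

sublocale \<mu>\<mu>: pair_prob_space \<mu> \<mu> ..

sublocale P: pair_prob_space \<mu> "\<mu> \<Otimes>\<^sub>M \<mu>" ..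

sublocale \<mu>_lborel: pair_sigma_finite \<mu> lborel ..

lemma g_measurable [measurable]: "g \<in> borel_measurable borel"
  using distributed_real_measurable[OF _ sum_distributed] g_nonneg by simp

lemma d_measurable [measurable]: "d \<in> borel_measurable borel"
  using distributed_real_measurable[OF _ diff_distributed] d_nonneg by simp

lemma nn_integral_\<mu>:
  assumes "\<phi> \<in> borel_measurable borel"
  shows "(\<integral>\<^sup>+x. \<phi> x \<partial>\<mu>) = (\<integral>\<^sup>+x. ennreal (f x) * \<phi> x \<partial>lborel)"
  using assms by (intro nn_integral_density) auto

lemma nn_integral_P:
  assumes [measurable]: "\<phi> \<in> borel_measurable P"
  shows "(\<integral>\<^sup>+p. \<phi> p \<partial>P) = (\<integral>\<^sup>+x. \<integral>\<^sup>+y. \<integral>\<^sup>+z. \<phi> (x, y, z) \<partial>\<mu> \<partial>\<mu> \<partial>\<mu>)"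
proof -
  have "(\<integral>\<^sup>+p. \<phi> p \<partial>P) = (\<integral>\<^sup>+x. \<integral>\<^sup>+q. \<phi> (x, q) \<partial>(\<mu> \<Otimes>\<^sub>M \<mu>) \<partial>\<mu>)"
    by (rule \<mu>\<mu>.P.nn_integral_fst[symmetric]) fact
  also have "\<dots> = (\<integral>\<^sup>+x. \<integral>\<^sup>+y. \<integral>\<^sup>+z. \<phi> (x, y, z) \<partial>\<mu> \<partial>\<mu> \<partial>\<mu>)"
    by (intro nn_integral_cong, subst \<mu>.nn_integral_fst[symmetric])
      (auto intro!: measurable_compose[OF _ assms])
  finally show ?thesis .
qed

text \<open>The point is the weight \<open>g\<close>: it cancels an inverse of \<open>g\<close> in
  the integrand. \<open>nn_integral_diff\<close> does the same for \<open>d\<close>.\<close>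

lemma nn_integral_sum:
  assumes [measurable]: "\<phi> \<in> borel_measurable borel"
  shows "(\<integral>\<^sup>+x. \<integral>\<^sup>+y. \<phi> (x + y) \<partial>\<mu> \<partial>\<mu>) = (\<integral>\<^sup>+s. ennreal (g s) * \<phi> s \<partial>lborel)"
  using distributed_nn_integral[OF sum_distributed, of \<phi>]
    \<mu>.nn_integral_fst[of "\<lambda>(x, y). \<phi> (x + y)" \<mu>]
  by (simp add: split_beta')

lemma nn_integral_diff:
  assumes [measurable]: "\<phi> \<in> borel_measurable borel"
  shows "(\<integral>\<^sup>+x. \<integral>\<^sup>+y. \<phi> (x - y) \<partial>\<mu> \<partial>\<mu>) = (\<integral>\<^sup>+s. ennreal (d s) * \<phi> s \<partial>lborel)"
  using distributed_nn_integral[OF diff_distributed, of \<phi>]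
    \<mu>.nn_integral_fst[of "\<lambda>(x, y). \<phi> (x - y)" \<mu>]
  by (simp add: split_beta')

lemma nn_integral_g: "(\<integral>\<^sup>+s. ennreal (g s) \<partial>lborel) = 1"
  using nn_integral_sum[of "\<lambda>_. 1"] \<mu>.emeasure_space_1 by simp

lemma nn_integral_d: "(\<integral>\<^sup>+s. ennreal (d s) \<partial>lborel) = 1"
  using nn_integral_diff[of "\<lambda>_. 1"] \<mu>.emeasure_space_1 by simp

lemma distr_P_eqI:
  assumes [measurable]: "\<pi> \<in> measurable P N"
    and eq: "\<And>A. A \<in> sets N \<Longrightarrow>
      (\<integral>\<^sup>+x. \<integral>\<^sup>+y. \<integral>\<^sup>+z. indicator A (\<pi> (x, y, z)) \<partial>\<mu> \<partial>\<mu> \<partial>\<mu>) = emeasure N A"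
  shows "distr P N \<pi> = N"
proof (rule measure_eqI)
  fix A assume "A \<in> sets (distr P N \<pi>)"
  then have [measurable]: "A \<in> sets N"
    by simp
  have "emeasure (distr P N \<pi>) A = (\<integral>\<^sup>+p. indicator A p \<partial>distr P N \<pi>)"
    by simp
  also have "\<dots> = (\<integral>\<^sup>+p. indicator A (\<pi> p) \<partial>P)"
    by (rule nn_integral_distr) auto
  also have "\<dots> = emeasure N A"
    by (subst nn_integral_P) (auto simp: eq)
  finally show "emeasure (distr P N \<pi>) A = emeasure N A" .
qed simp

lemma emeasure_pair_\<mu>:
  assumes [measurable]: "A \<in> sets (\<mu> \<Otimes>\<^sub>M \<mu>)"
  shows "(\<integral>\<^sup>+x. \<integral>\<^sup>+y. indicator A (x, y) \<partial>\<mu> \<partial>\<mu>) = emeasure (\<mu> \<Otimes>\<^sub>M \<mu>) A"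
  using assms by (subst \<mu>.nn_integral_fst) (auto simp del: sets_pair_measure_cong sets_density)

text \<open>The integrand is constant in a forgotten coordinate, and \<open>\<mu>\<close> has mass
  1; likewise for the other projections.\<close>

lemma distr_P_xy: "distr P (\<mu> \<Otimes>\<^sub>M \<mu>) (\<lambda>p. (fst p, fst (snd p))) = \<mu> \<Otimes>\<^sub>M \<mu>"
  by (rule distr_P_eqI) (auto simp: emeasure_pair_\<mu>[symmetric] \<mu>.emeasure_space_1[simplified])

lemma distr_P_xz: "distr P (\<mu> \<Otimes>\<^sub>M \<mu>) (\<lambda>p. (fst p, snd (snd p))) = \<mu> \<Otimes>\<^sub>M \<mu>"
  by (rule distr_P_eqI) (auto simp: emeasure_pair_\<mu>[symmetric] \<mu>.emeasure_space_1[simplified])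

lemma distr_P_yz: "distr P (\<mu> \<Otimes>\<^sub>M \<mu>) (\<lambda>p. snd p) = \<mu> \<Otimes>\<^sub>M \<mu>"
  by (rule distr_P_eqI) (auto simp: emeasure_pair_\<mu>[symmetric] \<mu>.emeasure_space_1[simplified])

lemma distr_P_z: "distr P \<mu> (\<lambda>p. snd (snd p)) = \<mu>"
  by (rule distr_P_eqI) (auto simp: \<mu>.emeasure_space_1[simplified])

lemma distributed_P:
  shows "distributed P lborel (\<lambda>(x, y, z). x + y) g"
    and "distributed P lborel (\<lambda>(x, y, z). x + z) g"
    and "distributed P lborel (\<lambda>(x, y, z). y + z) g"
    and "distributed P lborel (\<lambda>(x, y, z). x - y) d"
    and "distributed P lborel (\<lambda>(x, y, z). x - z) d"
    and "distributed P lborel (\<lambda>(x, y, z). y - z) d"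
    and "distributed P lborel (\<lambda>(x, y, z). z) f"
proof -
  have "distributed \<mu> lborel (\<lambda>z. z) f"
    by (auto simp: distributed_def distr_id2)
  from distributed_compose_measure_preserving[OF this _ distr_P_z]
  show "distributed P lborel (\<lambda>(x, y, z). z) f"
    by (simp add: split_beta')
qed (use distributed_compose_measure_preserving[OF sum_distributed _ distr_P_xy]
      distributed_compose_measure_preserving[OF sum_distributed _ distr_P_xz]
      distributed_compose_measure_preserving[OF sum_distributed _ distr_P_yz]
      distributed_compose_measure_preserving[OF diff_distributed _ distr_P_xy]
      distributed_compose_measure_preserving[OF diff_distributed _ distr_P_xz]
      distributed_compose_measure_preserving[OF diff_distributed _ distr_P_yz]
    in \<open>simp_all add: split_beta'\<close>)

text \<open>A log-density evaluated at its own variable has minus the entropy as its mean, so sums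
  of such terms over \<open>P\<close> become combinations of entropies.\<close>

lemma distributed_ln:
  fixes q :: "real \<Rightarrow> real"
  assumes D: "distributed P lborel T q" and q: "\<And>x. 0 \<le> q x"
    and int: "integrable lborel (\<lambda>x. q x * ln (q x))"
  shows "integrable P (\<lambda>p. ln (q (T p)))"
    and "(\<integral>p. ln (q (T p)) \<partial>P) = (\<integral>x. q x * ln (q x) \<partial>lborel)"
proof -
  have [measurable]: "q \<in> borel_measurable borel"
    using distributed_real_measurable[OF _ D] q by simp
  show "integrable P (\<lambda>p. ln (q (T p)))"
    using distributed_integrable[OF D, of "\<lambda>x. ln (q x)"] q int by simp
  show "(\<integral>p. ln (q (T p)) \<partial>P) = (\<integral>x. q x * ln (q x) \<partial>lborel)"
    using distributed_integral[OF D, of "\<lambda>x. ln (q x)"] q by simp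
qed

lemmas ln_P =
  distributed_ln[OF distributed_P(1) g_nonneg g_ln] distributed_ln[OF distributed_P(2) g_nonneg g_ln]
  distributed_ln[OF distributed_P(3) g_nonneg g_ln] distributed_ln[OF distributed_P(4) d_nonneg d_ln]
  distributed_ln[OF distributed_P(5) d_nonneg d_ln] distributed_ln[OF distributed_P(6) d_nonneg d_ln]
  distributed_ln[OF distributed_P(7) f_nonneg f_ln]

lemmas AE_pos_P = distributed_P[THEN distributed_AE_pos]

section \<open>The Ruzsa triangle inequality for the difference\<close>

lemma entropy_difference_le:
  "2 * (\<integral>x. g x * ln (g x) \<partial>lborel) \<le> (\<integral>x. d x * ln (d x) \<partial>lborel) + (\<integral>x. f x * ln (f x) \<partial>lborel)"
proof -
  \<comment> \<open>The ratio \<open>W\<close> with values in \<open>ennreal\<close>. The two differ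
    where a denominator vanishes, which happens on a null set only.\<close>
  define V :: "real \<times> real \<times> real \<Rightarrow> ennreal" where
    "V = (\<lambda>(x, y, z). inverse (ennreal (f z)) *
      (ennreal (g (x + z)) * ennreal (g (y + z)) * inverse (ennreal (d (x - y)))))"
  define L where "L = (\<lambda>(x, y, z). ln (g (x + z)) + ln (g (y + z)) - ln (d (x - y)) - ln (f z))"
  have [measurable]: "V \<in> borel_measurable P"
    unfolding V_def by measurable
  have L: "integrable P L"
    "(\<integral>p. L p \<partial>P) = 2 * (\<integral>x. g x * ln (g x) \<partial>lborel)
      - (\<integral>x. d x * ln (d x) \<partial>lborel) - (\<integral>x. f x * ln (f x) \<partial>lborel)"
    unfolding L_def using ln_P by (simp_all add: split_beta')
  have le: "AE p in P. ennreal (1 + L p) \<le> V p"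
    \<comment> \<open>These are the four densities in the ratio, at \<open>x + z\<close>,
      \<open>y + z\<close>, \<open>x - y\<close> and \<open>z\<close>.\<close>
    using AE_pos_P(2,3,4,7)
  proof eventually_elim
    case (elim p)
    obtain x y z where p: "p = (x, y, z)"
      by (cases p)
    define W where "W = g (x + z) * g (y + z) / (d (x - y) * f z)"
    have "0 < W"
      unfolding W_def using elim by (simp add: p)
    moreover have "L p = ln W"
      unfolding W_def L_def using elim by (simp add: p ln_mult ln_div)
    moreover have "V p = ennreal W"
      unfolding W_def V_def using elim
      by (simp add: p inverse_ennreal ennreal_mult[symmetric] field_simps)
    ultimately show ?case
      using ln_le_minus_one[of W] by (auto intro: ennreal_leI)
  qed
  \<comment> \<open>The autocorrelation of \<open>g\<close>. Integrating \<open>V\<close> over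
    \<open>z\<close> first cancels \<open>f z\<close>, and \<open>s = y + z\<close> shows that what
    remains depends on \<open>x - y\<close> alone.\<close>
  define H where "H u = (\<integral>\<^sup>+s. ennreal (g (s + u)) * ennreal (g s) \<partial>lborel)" for u
  have [measurable]: "H \<in> borel_measurable borel"
    unfolding H_def by measurable
  have "(\<integral>\<^sup>+p. V p \<partial>P) \<le> (\<integral>\<^sup>+x. \<integral>\<^sup>+y. H (x - y) * inverse (ennreal (d (x - y))) \<partial>\<mu> \<partial>\<mu>)"
  proof (subst nn_integral_P, measurable, intro nn_integral_mono)
    fix x y :: real
    have "(\<integral>\<^sup>+z. V (x, y, z) \<partial>\<mu>) = (\<integral>\<^sup>+z. ennreal (f z) * V (x, y, z) \<partial>lborel)"
      unfolding V_def by (subst nn_integral_\<mu>) auto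
    also have "\<dots> \<le> (\<integral>\<^sup>+z. ennreal (g (x + z)) * ennreal (g (y + z)) * inverse (ennreal (d (x - y))) \<partial>lborel)"
      unfolding V_def prod.case
      by (intro nn_integral_mono) (metis ennreal_mult_inverse_le mult.commute)
    also have "\<dots> = (\<integral>\<^sup>+z. ennreal (g (x + z)) * ennreal (g (y + z)) \<partial>lborel) * inverse (ennreal (d (x - y)))"
      by (rule nn_integral_multc) measurable
    also have "(\<integral>\<^sup>+z. ennreal (g (x + z)) * ennreal (g (y + z)) \<partial>lborel) = H (x - y)"
      unfolding H_def
      by (subst nn_integral_lborel_shift[of _ y, symmetric]) (auto simp: algebra_simps)
    finally show "(\<integral>\<^sup>+z. V (x, y, z) \<partial>\<mu>) \<le> H (x - y) * inverse (ennreal (d (x - y)))" .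
  qed
  \<comment> \<open>The law of \<open>x - y\<close> supplies the weight \<open>d\<close> that
    cancels the denominator; the integral of \<open>H\<close> is the square of the integral of
    \<open>g\<close>, which is 1.\<close>
  also have "\<dots> = (\<integral>\<^sup>+u. ennreal (d u) * (H u * inverse (ennreal (d u))) \<partial>lborel)"
    by (subst nn_integral_diff[of "\<lambda>u. H u * inverse (ennreal (d u))"]) auto
  also have "\<dots> \<le> (\<integral>\<^sup>+u. H u \<partial>lborel)"
    by (intro nn_integral_mono ennreal_mult_inverse_le)
  also have "\<dots> = (\<integral>\<^sup>+s. \<integral>\<^sup>+u. ennreal (g (s + u)) * ennreal (g s) \<partial>lborel \<partial>lborel)"
    unfolding H_def by (subst lborel_pair.Fubini') auto
  also have "\<dots> = 1"
    using nn_integral_lborel_shift[of "\<lambda>x. ennreal (g x)"]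
    by (simp add: nn_integral_multc nn_integral_g add.commute)
  finally have "(\<integral>\<^sup>+p. V p \<partial>P) \<le> 1" .
  from P.integral_nonpos_if_add_1_le[OF L(1) le this] show ?thesis
    by (simp add: L(2))
qed

section \<open>The bound for the sum, by way of \<open>x + y - z\<close>\<close>

text \<open>The density of \<open>x + y - z\<close>, as the convolution of \<open>f\<close> and \<open>d\<close>.\<close>

definition k :: "real \<Rightarrow> ennreal" where
  "k t = (\<integral>\<^sup>+x. ennreal (d (t - x)) \<partial>\<mu>)"

lemma k_measurable [measurable]: "k \<in> borel_measurable borel"
  unfolding k_def by measurable

text \<open>The same convolution with the value \<open>a\<close> of the difference as integration
  variable; \<open>entropy_sum_le\<close> needs both forms.\<close>

lemma k_eq: "k t = (\<integral>\<^sup>+a. ennreal (d a) * ennreal (f (t - a)) \<partial>lborel)"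
  unfolding k_def
  by (subst nn_integral_\<mu>, simp, subst nn_integral_lborel_reflect[of _ t, symmetric])
    (auto simp: mult.commute)

lemma nn_integral_k: "(\<integral>\<^sup>+t. k t \<partial>lborel) = 1"
proof -
  have "(\<integral>\<^sup>+t. k t \<partial>lborel) = (\<integral>\<^sup>+x. \<integral>\<^sup>+t. ennreal (d (t - x)) \<partial>lborel \<partial>\<mu>)"
    unfolding k_def by (subst \<mu>_lborel.Fubini') auto
  also have "\<dots> = 1"
    using nn_integral_lborel_shift[of "\<lambda>x. ennreal (d x)" "- x" for x] \<mu>.emeasure_space_1
    by (simp add: nn_integral_d)
  finally show ?thesis .
qed

text \<open>Since \<open>k\<close> is the density of \<open>x + y - z\<close>, its zero set is null
  under that law; it is infinite only on a Lebesgue null set because its integral is 1.\<close>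

lemma AE_k: "AE (x, y, z) in P. 0 < k (x + y - z) \<and> k (x + y - z) < \<top>"
proof -
  define A where "A = {t. k t = 0 \<or> k t = \<top>}"
  have [measurable]: "A \<in> sets borel"
    unfolding A_def by measurable
  \<comment> \<open>Grouping \<open>y - z\<close> lets its density \<open>d\<close> enter; the shift
    \<open>t = x + u\<close> then produces \<open>k\<close>.\<close>
  have "(\<integral>\<^sup>+(x, y, z). indicator A (x + y - z) \<partial>P) = (\<integral>\<^sup>+x. \<integral>\<^sup>+y. \<integral>\<^sup>+z. indicator A (x + (y - z)) \<partial>\<mu> \<partial>\<mu> \<partial>\<mu>)"
    by (subst nn_integral_P) (auto simp: add_diff_eq)
  also have "\<dots> = (\<integral>\<^sup>+x. \<integral>\<^sup>+u. ennreal (d u) * indicator A (x + u) \<partial>lborel \<partial>\<mu>)"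
    by (subst nn_integral_diff[of "\<lambda>u. indicator A (x + u)" for x]) auto
  also have "\<dots> = (\<integral>\<^sup>+x. \<integral>\<^sup>+t. ennreal (d (t - x)) * indicator A t \<partial>lborel \<partial>\<mu>)"
  proof (rule nn_integral_cong)
    fix x :: real
    show "(\<integral>\<^sup>+u. ennreal (d u) * indicator A (x + u) \<partial>lborel)
        = (\<integral>\<^sup>+t. ennreal (d (t - x)) * indicator A t \<partial>lborel)"
      using nn_integral_lborel_shift[of "\<lambda>t. ennreal (d (t - x)) * indicator A t" x]
      by (simp add: add.commute)
  qed
  also have "\<dots> = (\<integral>\<^sup>+t. \<integral>\<^sup>+x. ennreal (d (t - x)) * indicator A t \<partial>\<mu> \<partial>lborel)"
    by (subst \<mu>_lborel.Fubini') auto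
  also have "\<dots> = (\<integral>\<^sup>+t. k t * indicator A t \<partial>lborel)"
    unfolding k_def by (intro nn_integral_cong nn_integral_multc) auto
  also have "\<dots> = (\<integral>\<^sup>+t. 0 \<partial>(lborel :: real measure))"
  proof (rule nn_integral_cong_AE)
    have "AE t in lborel. k t \<noteq> \<infinity>"
      by (rule nn_integral_noteq_infinite) (auto simp: nn_integral_k)
    then show "AE t in lborel. k t * indicator A t = 0"
      by eventually_elim (auto simp: A_def split: split_indicator)
  qed
  finally have "(\<integral>\<^sup>+(x, y, z). indicator A (x + y - z) \<partial>P) = 0"
    by simp
  then have "AE p in P. (case p of (x, y, z) \<Rightarrow> indicator A (x + y - z)) = (0 :: ennreal)"
    by (subst (asm) nn_integral_0_iff_AE) auto
  then show ?thesis
    by eventually_elim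
      (auto simp: A_def indicator_def top.not_eq_extremum zero_less_iff_neq_zero split: if_splits)
qed

text \<open>In entropies, \<open>V1\<close> encodes
  \<open>h(x + y - z) + h(z) \<le> h(x - z) + h(y - z)\<close> and \<open>V2\<close> encodes
  \<open>h(x + y) \<le> h(x + y - z)\<close>. Only their sum is integrated, where the entropy of
  \<open>x + y - z\<close> has dropped out.\<close>

lemma entropy_sum_le:
  "2 * (\<integral>x. d x * ln (d x) \<partial>lborel) \<le> (\<integral>x. g x * ln (g x) \<partial>lborel) + (\<integral>x. f x * ln (f x) \<partial>lborel)"
proof -
  define V1 :: "real \<times> real \<times> real \<Rightarrow> ennreal" where
    "V1 = (\<lambda>(x, y, z). inverse (ennreal (f z)) *
      (ennreal (d (x - z)) * ennreal (d (y - z)) * inverse (k (x + y - z))))"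
  define V2 :: "real \<times> real \<times> real \<Rightarrow> ennreal" where
    "V2 = (\<lambda>(x, y, z). k (x + y - z) * inverse (ennreal (g (x + y))))"
  \<comment> \<open>Halving turns the two bounds \<open>ln W \<le> W - 1\<close> into
    \<open>1 + L \<le> (W1 + W2) / 2\<close>, whose right side again has mean at most 1.\<close>
  define L where
    "L = (\<lambda>(x, y, z). (ln (d (x - z)) + ln (d (y - z)) - ln (g (x + y)) - ln (f z)) / 2)"
  have [measurable]: "V1 \<in> borel_measurable P" "V2 \<in> borel_measurable P"
    unfolding V1_def V2_def by measurable
  have L: "integrable P L"
    "(\<integral>p. L p \<partial>P) = (2 * (\<integral>x. d x * ln (d x) \<partial>lborel)
      - (\<integral>x. g x * ln (g x) \<partial>lborel) - (\<integral>x. f x * ln (f x) \<partial>lborel)) / 2"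
    unfolding L_def using ln_P by (simp_all add: split_beta')
  have le: "AE p in P. ennreal (1 + L p) \<le> (V1 p + V2 p) / 2"
    using AE_pos_P(1,5,6,7) AE_k
  proof eventually_elim
    case (elim p)
    obtain x y z where p: "p = (x, y, z)"
      by (cases p)
    \<comment> \<open>The real value of \<open>k\<close>, available by \<open>AE_k\<close>; it
      cancels in \<open>ln W1 + ln W2\<close>.\<close>
    obtain r where r: "k (x + y - z) = ennreal r" "0 < r"
      using elim by (cases "k (x + y - z)") (auto simp: p)
    define W1 where "W1 = d (x - z) * d (y - z) / (r * f z)"
    define W2 where "W2 = r / g (x + y)"
    have "0 < W1" "0 < W2"
      unfolding W1_def W2_def using elim r by (simp_all add: p)
    moreover have "2 * L p = ln W1 + ln W2"
      unfolding W1_def W2_def L_def using elim r by (simp add: p ln_mult ln_div)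
    moreover have "V1 p = ennreal W1" "V2 p = ennreal W2"
      unfolding W1_def W2_def V1_def V2_def using elim r
      by (simp_all add: p inverse_ennreal ennreal_mult[symmetric] field_simps)
    moreover have "ennreal (1 + L p) \<le> ennreal ((W1 + W2) / 2)"
      using calculation ln_le_minus_one[of W1] ln_le_minus_one[of W2] by (intro ennreal_leI) simp
    ultimately show ?case
      using divide_ennreal[of "W1 + W2" 2] by simp
  qed
  have "(\<integral>\<^sup>+p. V1 p \<partial>P) \<le> (\<integral>\<^sup>+x. \<integral>\<^sup>+y. \<integral>\<^sup>+a.
      ennreal (d a) * ennreal (d (y + a - x)) * inverse (k (y + a)) \<partial>lborel \<partial>\<mu> \<partial>\<mu>)"
  proof (subst nn_integral_P, measurable, intro nn_integral_mono)
    fix x y :: real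
    have "(\<integral>\<^sup>+z. V1 (x, y, z) \<partial>\<mu>) = (\<integral>\<^sup>+z. ennreal (f z) * V1 (x, y, z) \<partial>lborel)"
      unfolding V1_def by (subst nn_integral_\<mu>) auto
    also have "\<dots> \<le> (\<integral>\<^sup>+z. ennreal (d (x - z)) * ennreal (d (y - z)) * inverse (k (x + y - z)) \<partial>lborel)"
      unfolding V1_def prod.case
      by (intro nn_integral_mono) (metis ennreal_mult_inverse_le mult.commute)
    \<comment> \<open>Substitution \<open>a = x - z\<close>.\<close>
    also have "\<dots> = (\<integral>\<^sup>+a. ennreal (d a) * ennreal (d (y + a - x)) * inverse (k (y + a)) \<partial>lborel)"
      by (subst nn_integral_lborel_reflect[of _ x, symmetric]) (auto simp: algebra_simps)
    finally show "(\<integral>\<^sup>+z. V1 (x, y, z) \<partial>\<mu>) \<le> \<dots>" .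
  qed
  also have "\<dots> = (\<integral>\<^sup>+x. \<integral>\<^sup>+t. k t * ennreal (d (t - x)) * inverse (k t) \<partial>lborel \<partial>\<mu>)"
  proof (intro nn_integral_cong)
    fix x :: real
    have "(\<integral>\<^sup>+y. \<integral>\<^sup>+a. ennreal (d a) * ennreal (d (y + a - x)) * inverse (k (y + a)) \<partial>lborel \<partial>\<mu>)
        = (\<integral>\<^sup>+a. \<integral>\<^sup>+y. ennreal (d a) * ennreal (d (y + a - x)) * inverse (k (y + a)) \<partial>\<mu> \<partial>lborel)"
      by (subst \<mu>_lborel.Fubini') auto
    \<comment> \<open>Substitution \<open>t = y + a\<close>. Now \<open>a\<close> occurs only in
      \<open>d a\<close> and \<open>f (t - a)\<close>, so integrating it out gives
      \<open>k t\<close> by \<open>k_eq\<close>, which cancels the denominator.\<close>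
    also have "\<dots> = (\<integral>\<^sup>+a. \<integral>\<^sup>+t. ennreal (d a) * ennreal (f (t - a)) * (ennreal (d (t - x)) * inverse (k t)) \<partial>lborel \<partial>lborel)"
    proof (intro nn_integral_cong)
      fix a :: real
      let ?\<phi> = "\<lambda>t. ennreal (d a) * ennreal (f (t - a)) * (ennreal (d (t - x)) * inverse (k t))"
      show "(\<integral>\<^sup>+y. ennreal (d a) * ennreal (d (y + a - x)) * inverse (k (y + a)) \<partial>\<mu>) = (\<integral>\<^sup>+t. ?\<phi> t \<partial>lborel)"
        using nn_integral_lborel_shift[of ?\<phi> a] by (subst nn_integral_\<mu>) (auto simp: ac_simps)
    qed
    also have "\<dots> = (\<integral>\<^sup>+t. \<integral>\<^sup>+a. ennreal (d a) * ennreal (f (t - a)) * (ennreal (d (t - x)) * inverse (k t)) \<partial>lborel \<partial>lborel)"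
      by (subst lborel_pair.Fubini') auto
    also have "\<dots> = (\<integral>\<^sup>+t. k t * ennreal (d (t - x)) * inverse (k t) \<partial>lborel)"
      by (simp add: nn_integral_multc k_eq[symmetric]) (simp add: mult.assoc)
    finally show "(\<integral>\<^sup>+y. \<integral>\<^sup>+a. ennreal (d a) * ennreal (d (y + a - x)) * inverse (k (y + a)) \<partial>lborel \<partial>\<mu>) = \<dots>" .
  qed
  also have "\<dots> \<le> (\<integral>\<^sup>+x. \<integral>\<^sup>+t. ennreal (d (t - x)) \<partial>lborel \<partial>\<mu>)"
    by (intro nn_integral_mono) (simp add: mult.assoc ennreal_mult_inverse_le)
  also have "\<dots> = (\<integral>\<^sup>+t. k t \<partial>lborel)"
    unfolding k_def by (subst \<mu>_lborel.Fubini') auto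
  finally have V1: "(\<integral>\<^sup>+p. V1 p \<partial>P) \<le> 1"
    by (simp add: nn_integral_k)

  \<comment> \<open>The convolution of \<open>k\<close> with \<open>f\<close>, of mass 1: it is what
    integrating the numerator of \<open>V2\<close> over \<open>z\<close> leaves, as
    \<open>g (x + y)\<close> does not involve \<open>z\<close>.\<close>
  define H where "H s = (\<integral>\<^sup>+z. k (s - z) \<partial>\<mu>)" for s
  have [measurable]: "H \<in> borel_measurable borel"
    unfolding H_def by measurable
  have "(\<integral>\<^sup>+p. V2 p \<partial>P) = (\<integral>\<^sup>+x. \<integral>\<^sup>+y. H (x + y) * inverse (ennreal (g (x + y))) \<partial>\<mu> \<partial>\<mu>)"
    unfolding H_def V2_def by (subst nn_integral_P) (auto simp: nn_integral_multc)
  also have "\<dots> = (\<integral>\<^sup>+s. ennreal (g s) * (H s * inverse (ennreal (g s))) \<partial>lborel)"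
    by (subst nn_integral_sum[of "\<lambda>s. H s * inverse (ennreal (g s))"]) auto
  also have "\<dots> \<le> (\<integral>\<^sup>+s. H s \<partial>lborel)"
    by (intro nn_integral_mono ennreal_mult_inverse_le)
  also have "\<dots> = (\<integral>\<^sup>+z. \<integral>\<^sup>+s. k (s - z) \<partial>lborel \<partial>\<mu>)"
    unfolding H_def by (subst \<mu>_lborel.Fubini') auto
  also have "\<dots> = 1"
    using nn_integral_lborel_shift[of k "- z" for z] \<mu>.emeasure_space_1
    by (simp add: nn_integral_k)
  finally have V2: "(\<integral>\<^sup>+p. V2 p \<partial>P) \<le> 1" .

  have "(\<integral>\<^sup>+p. (V1 p + V2 p) / 2 \<partial>P) = ((\<integral>\<^sup>+p. V1 p \<partial>P) + (\<integral>\<^sup>+p. V2 p \<partial>P)) / 2"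
    by (simp add: nn_integral_divide nn_integral_add)
  also have "\<dots> \<le> (1 + 1) / 2"
    using V1 V2 by (intro divide_right_mono_ennreal add_mono)
  also have "\<dots> = 1"
    by (simp add: one_add_one)
  finally show ?thesis
    using P.integral_nonpos_if_add_1_le[OF L(1) le] by (simp add: L(2))
qed

end

section \<open>Return to the random variables\<close>

lemma (in prob_space) diff_entropy_eq:
  assumes "distributed M lborel X (\<lambda>x. ennreal (f x))" "\<And>x. 0 \<le> f x"
  shows "diff_entropy M X = - (\<integral>x. f x * ln (f x) \<partial>lborel)"
proof -
  interpret information_space M "exp 1"
    by unfold_locales simp
  show ?thesis
    unfolding diff_entropy_def using entropy_distr[OF assms(1)] assms(2) by (simp add: log_ln[symmetric])
qed

theorem mainTheorem5:
  fixes M :: "'a measure" and X1 X2 :: "'a \<Rightarrow> real"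
  assumes "prob_space M"
    and "prob_space.indep_var M borel X1 borel X2"
    and "distr M borel X1 = distr M borel X2"
    and "has_finite_diff_entropy M X1"
    and "has_finite_diff_entropy M (\<lambda>\<omega>. X1 \<omega> + X2 \<omega>)"
    and "has_finite_diff_entropy M (\<lambda>\<omega>. X1 \<omega> - X2 \<omega>)"
  shows "diff_entropy M (\<lambda>\<omega>. X1 \<omega> + X2 \<omega>) - diff_entropy M X1
           \<le> 2 * (diff_entropy M (\<lambda>\<omega>. X1 \<omega> - X2 \<omega>) - diff_entropy M X1)
       \<and> diff_entropy M (\<lambda>\<omega>. X1 \<omega> - X2 \<omega>) - diff_entropy M X1
           \<le> 2 * (diff_entropy M (\<lambda>\<omega>. X1 \<omega> + X2 \<omega>) - diff_entropy M X1)"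
proof -
  interpret prob_space M by fact
  \<comment> \<open>\<open>diff_entropy_eq\<close> accepts any nonnegative density, so these
    witnesses can be used as they come.\<close>
  obtain f g d :: "real \<Rightarrow> real" where
    f: "\<And>x. 0 \<le> f x" "distributed M lborel X1 f" "integrable lborel (\<lambda>x. f x * ln (f x))" and
    g: "\<And>x. 0 \<le> g x" "distributed M lborel (\<lambda>\<omega>. X1 \<omega> + X2 \<omega>) g" "integrable lborel (\<lambda>x. g x * ln (g x))" and
    d: "\<And>x. 0 \<le> d x" "distributed M lborel (\<lambda>\<omega>. X1 \<omega> - X2 \<omega>) d" "integrable lborel (\<lambda>x. d x * ln (d x))"
    using assms(4-6) unfolding has_finite_diff_entropy_def by blast
  let ?\<mu> = "density lborel (\<lambda>x. ennreal (f x))"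
  have [measurable]: "X1 \<in> borel_measurable M" "X2 \<in> borel_measurable M"
    and joint: "distr M borel X1 \<Otimes>\<^sub>M distr M borel X2 = distr M (borel \<Otimes>\<^sub>M borel) (\<lambda>\<omega>. (X1 \<omega>, X2 \<omega>))"
    using assms(2) by (simp_all add: indep_var_distribution_eq)
  have law: "distr M borel X1 = ?\<mu>"
    using distributed_distr_eq_density[OF f(2)] by (simp cong: distr_cong)
  \<comment> \<open>Independence makes the joint law a product, and equality in law makes both
    factors \<open>?\<mu>\<close>; the laws of sum and difference are its images.\<close>
  have pair: "?\<mu> \<Otimes>\<^sub>M ?\<mu> = distr M (borel \<Otimes>\<^sub>M borel) (\<lambda>\<omega>. (X1 \<omega>, X2 \<omega>))"
    using joint assms(3) law by simp
  interpret iid_sum_difference f g d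
  proof (rule iid_sum_difference.intro)
    show "prob_space ?\<mu>"
      unfolding law[symmetric] by (rule prob_space_distr) simp
    show "f \<in> borel_measurable borel"
      using distributed_real_measurable[OF _ f(2)] f(1) by simp
    show "distributed (?\<mu> \<Otimes>\<^sub>M ?\<mu>) lborel (\<lambda>(x, y). x + y) g"
      "distributed (?\<mu> \<Otimes>\<^sub>M ?\<mu>) lborel (\<lambda>(x, y). x - y) d"
      unfolding pair using g(2) d(2)
      by (simp_all add: distributed_def distr_distr comp_def)
  qed (use f g d in auto)
  show ?thesis
    unfolding diff_entropy_eq[OF f(2,1)] diff_entropy_eq[OF g(2,1)] diff_entropy_eq[OF d(2,1)]
    \<comment> \<open>After rearrangement, \<open>entropy_sum_le\<close> is the first conjunct and
      \<open>entropy_difference_le\<close> the second.\<close>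
    using entropy_difference_le entropy_sum_le by simp
qed

end
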